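(* Let $\lambda X$ be a pure type system with specification $(\mathcal S,\mathcal A,\mathcal R)$. Suppose there are $n\in\mathbb N$ with $n>1$ and sorts $s_1,\dots,s_n\in\mathcal S$ such that $s_1=s_n\in\mathcal N$ and for each $1\le i<n$ there is $s'\in\mathcal I$ with $(s',s_i,s_{i+1})\in\mathcal R$; and suppose moreover that for all $(s_1',s_2',s_3')\in\mathcal R$ we have $(s_1:s_2')\notin\mathcal A$. Then there is no Hilbert-style pure type system equivalent to $\lambda X$.
   Context: Pure type systems (PTS). A PTS has an infinite set $V$ of variables, a set $\mathcal C$ of constants, a set of sorts $\mathcal S\subseteq\mathcal C$, axioms $\mathcal A$ of the form $c:s$ ($c\in\mathcal C,s\in\mathcal S$) and rules $\mathcal R\subseteq\mathcal S^3$. Pseudoterms: $\mathcal T::=V\mid\mathcal C\mid\Pi V{:}\mathcal T.\mathcal T\mid\lambda V{:}\mathcal T.\mathcal T\mid\mathcal T\mathcal T$. Judgements $\Gamma\vdash M:A$ with $\Gamma$ a finite sequence of declarations $x:A$. Rules: (axiom) $\vdash c:s$ for $(c:s)\in\mathcal A$; (start) from $\Gamma\vdash A:s$ infer $\Gamma,x:A\vdash x:A$ ($x$ fresh); (weakening) from $\Gamma\vdash M:B$ and $\Gamma\vdash A:s$ infer $\Gamma,x:A\vdash M:B$ ($x$ fresh); (application) from $\Gamma\vdash M:(\Pi x{:}A.B)$ and $\Gamma\vdash N:A$ infer $\Gamma\vdash MN:B[x:=N]$; (abstraction) from $\Gamma,x:A\vdash M:B$ and $\Gamma\vdash(\Pi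 x{:}A.B):s$ infer $\Gamma\vdash(\lambda x{:}A.M):(\Pi x{:}A.B)$; (product) from $\Gamma,x:A\vdash B:s_2$, $\Gamma\vdash A:s_1$, $(s_1,s_2,s_3)\in\mathcal R$ infer $\Gamma\vdash(\Pi x{:}A.B):s_3$; (conversion) from $\Gamma\vdash M:A$, $\Gamma\vdash B:s$, $A=_\beta B$ infer $\Gamma\vdash M:B$ (here $s,s_i$ range over $\mathcal S$). A sort $s$ is inhabited ($s\in\mathcal I$) if $\vdash A:s$ is derivable for some $A$; it is normal form inhabited ($s\in\mathcal N$) if $\vdash A:s$ for some $A$ in $\beta$-normal form. Hilbert-style PTS (HPTS): same $V,\mathcal C,\mathcal S,\mathcal T$, only empty contexts, axioms $\mathcal A$ plus a finite set $\mathcal B$ of axiom schemes (judgements $\vdash M:A$ whose sort variables may be instantiated by sorts); rules: the axioms, (application) and (conversion) with empty contexts, (type reduction) from $\vdash M:A$ and $A\to_\beta B$ infer $\vdash M:B$, and (subject reduction) from $\vdash M:A$ and $M\to_\beta N$ infer $\vdash N:A$. An HPTS with specification $(\mathcal S,\mathcal A,\mathcal B)$ is equivalent to the PTS $(\mathcal S,\mathcal A,\mathcal R)$ if for all $M,A$: $\vdash M:A$ is derivable in the PTS iff it is derivable in the HPTS. *)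

theory Defs
  imports Main
begin

text \<open>Pseudoterms are represented modulo \<open>\<alpha>\<close>-equivalence by de Bruijn indices; the type
  variable \<open>'c\<close> is the set of constants.  In \<open>Prd A B\<close> (the product \<open>\<Pi>x:A. B\<close>) and
  \<open>Lam A M\<close> (the abstraction \<open>\<lambda>x:A. M\<close>) the index 0 is bound in the second argument only.\<close>

datatype 'c pterm =
    Var nat
  | Cst 'c
  | Prd "'c pterm" "'c pterm"
  | Lam "'c pterm" "'c pterm"
  | App "'c pterm" "'c pterm"

primrec lift :: "nat \<Rightarrow> 'c pterm \<Rightarrow> 'c pterm" where
  "lift k (Var i) = (if i < k then Var i else Var (Suc i))"
| "lift k (Cst c) = Cst c"
| "lift k (Prd A B) = Prd (lift k A) (lift (Suc k) B)"
| "lift k (Lam A M) = Lam (lift k A) (lift (Suc k) M)"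
| "lift k (App M N) = App (lift k M) (lift k N)"

text \<open>\<open>subst k N M\<close> replaces index \<open>k\<close> in \<open>M\<close> by \<open>N\<close> and lowers the indices above \<open>k\<close>,
  so \<open>subst 0 N B\<close> is \<open>B[x:=N]\<close> for the variable \<open>x\<close> that a binder around \<open>B\<close> binds.\<close>

primrec subst :: "nat \<Rightarrow> 'c pterm \<Rightarrow> 'c pterm \<Rightarrow> 'c pterm" where
  "subst k N (Var i) = (if i < k then Var i else if i = k then N else Var (i - 1))"
| "subst k N (Cst c) = Cst c"
| "subst k N (Prd A B) = Prd (subst k N A) (subst (Suc k) (lift 0 N) B)"
| "subst k N (Lam A M) = Lam (subst k N A) (subst (Suc k) (lift 0 N) M)"
| "subst k N (App M P) = App (subst k N M) (subst k N P)"

inductive beta :: "'c pterm \<Rightarrow> 'c pterm \<Rightarrow> bool"  (infix \<open>\<rightarrow>\<^sub>\<beta>\<close> 50) where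
  beta: "App (Lam A M) N \<rightarrow>\<^sub>\<beta> subst 0 N M"
| Prd1: "A \<rightarrow>\<^sub>\<beta> A' \<Longrightarrow> Prd A B \<rightarrow>\<^sub>\<beta> Prd A' B"
| Prd2: "B \<rightarrow>\<^sub>\<beta> B' \<Longrightarrow> Prd A B \<rightarrow>\<^sub>\<beta> Prd A B'"
| Lam1: "A \<rightarrow>\<^sub>\<beta> A' \<Longrightarrow> Lam A M \<rightarrow>\<^sub>\<beta> Lam A' M"
| Lam2: "M \<rightarrow>\<^sub>\<beta> M' \<Longrightarrow> Lam A M \<rightarrow>\<^sub>\<beta> Lam A M'"
| App1: "M \<rightarrow>\<^sub>\<beta> M' \<Longrightarrow> App M N \<rightarrow>\<^sub>\<beta> App M' N"
| App2: "N \<rightarrow>\<^sub>\<beta> N' \<Longrightarrow> App M N \<rightarrow>\<^sub>\<beta> App M N'"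

abbreviation beta_eq :: "'c pterm \<Rightarrow> 'c pterm \<Rightarrow> bool"  (infix \<open>=\<^sub>\<beta>\<close> 50) where
  "M =\<^sub>\<beta> N \<equiv> equivclp beta M N"

definition beta_normal :: "'c pterm \<Rightarrow> bool" where
  "beta_normal M \<longleftrightarrow> (\<nexists>N. M \<rightarrow>\<^sub>\<beta> N)"

definition pts_spec :: "'c set \<Rightarrow> ('c \<times> 'c) set \<Rightarrow> ('c \<times> 'c \<times> 'c) set \<Rightarrow> bool" where
  "pts_spec S Ax R \<longleftrightarrow> Ax \<subseteq> UNIV \<times> S \<and> R \<subseteq> S \<times> S \<times> S"

text \<open>Contexts are lists whose head is the most recent declaration; each type in a context
  lives over the declarations to its right, which is why \<open>start\<close> and \<open>weakening\<close> lift.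
  Freshness of the declared variable is automatic.\<close>

inductive pts :: "'c set \<Rightarrow> ('c \<times> 'c) set \<Rightarrow> ('c \<times> 'c \<times> 'c) set
    \<Rightarrow> 'c pterm list \<Rightarrow> 'c pterm \<Rightarrow> 'c pterm \<Rightarrow> bool"
  for S :: "'c set" and Ax :: "('c \<times> 'c) set" and R :: "('c \<times> 'c \<times> 'c) set"
where
  axiom: "(c, s) \<in> Ax \<Longrightarrow> pts S Ax R [] (Cst c) (Cst s)"
| start: "\<lbrakk>pts S Ax R \<Gamma> A (Cst s); s \<in> S\<rbrakk>
    \<Longrightarrow> pts S Ax R (A # \<Gamma>) (Var 0) (lift 0 A)"
| weakening: "\<lbrakk>pts S Ax R \<Gamma> M B; pts S Ax R \<Gamma> A (Cst s); s \<in> S\<rbrakk>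
    \<Longrightarrow> pts S Ax R (A # \<Gamma>) (lift 0 M) (lift 0 B)"
| application: "\<lbrakk>pts S Ax R \<Gamma> M (Prd A B); pts S Ax R \<Gamma> N A\<rbrakk>
    \<Longrightarrow> pts S Ax R \<Gamma> (App M N) (subst 0 N B)"
| abstraction: "\<lbrakk>pts S Ax R (A # \<Gamma>) M B; pts S Ax R \<Gamma> (Prd A B) (Cst s); s \<in> S\<rbrakk>
    \<Longrightarrow> pts S Ax R \<Gamma> (Lam A M) (Prd A B)"
| product: "\<lbrakk>pts S Ax R (A # \<Gamma>) B (Cst s2); pts S Ax R \<Gamma> A (Cst s1); (s1, s2, s3) \<in> R\<rbrakk>
    \<Longrightarrow> pts S Ax R \<Gamma> (Prd A B) (Cst s3)"
| conversion: "\<lbrakk>pts S Ax R \<Gamma> M A; pts S Ax R \<Gamma> B (Cst s); s \<in> S; A =\<^sub>\<beta> B\<rbrakk>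
    \<Longrightarrow> pts S Ax R \<Gamma> M B"

definition inhabited_sorts :: "'c set \<Rightarrow> ('c \<times> 'c) set \<Rightarrow> ('c \<times> 'c \<times> 'c) set \<Rightarrow> 'c set" where
  "inhabited_sorts S Ax R = {s \<in> S. \<exists>A. pts S Ax R [] A (Cst s)}"

definition nf_inhabited_sorts :: "'c set \<Rightarrow> ('c \<times> 'c) set \<Rightarrow> ('c \<times> 'c \<times> 'c) set \<Rightarrow> 'c set" where
  "nf_inhabited_sorts S Ax R = {s \<in> S. \<exists>A. beta_normal A \<and> pts S Ax R [] A (Cst s)}"

text \<open>An axiom scheme is a judgement \<open>\<turnstile> M : A\<close> whose atoms are either constants (\<open>Inl c\<close>) or
  sort variables (\<open>Inr v\<close>).  Only the sort variables that occur in the scheme have to be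
  instantiated by sorts, so a scheme without sort variables has itself as an instance even
  if there are no sorts.\<close>

type_synonym 'c scheme = "('c + nat) pterm \<times> ('c + nat) pterm"

definition inst :: "(nat \<Rightarrow> 'c) \<Rightarrow> ('c + nat) pterm \<Rightarrow> 'c pterm" where
  "inst \<sigma> = map_pterm (case_sum (\<lambda>c. c) \<sigma>)"

definition sort_vars :: "('c + nat) pterm \<Rightarrow> nat set" where
  "sort_vars M = {v. Inr v \<in> set_pterm M}"

definition hpts_spec :: "'c set \<Rightarrow> ('c \<times> 'c) set \<Rightarrow> 'c scheme set \<Rightarrow> bool" where
  "hpts_spec S Ax \<B> \<longleftrightarrow> Ax \<subseteq> UNIV \<times> S \<and> finite \<B>"

inductive hpts :: "'c set \<Rightarrow> ('c \<times> 'c) set \<Rightarrow> 'c scheme set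
    \<Rightarrow> 'c pterm \<Rightarrow> 'c pterm \<Rightarrow> bool"
  for S :: "'c set" and Ax :: "('c \<times> 'c) set" and \<B> :: "'c scheme set"
where
  axiom: "(c, s) \<in> Ax \<Longrightarrow> hpts S Ax \<B> (Cst c) (Cst s)"
| scheme: "\<lbrakk>(M, A) \<in> \<B>; \<And>v. v \<in> sort_vars M \<union> sort_vars A \<Longrightarrow> \<sigma> v \<in> S\<rbrakk>
    \<Longrightarrow> hpts S Ax \<B> (inst \<sigma> M) (inst \<sigma> A)"
| application: "\<lbrakk>hpts S Ax \<B> M (Prd A B); hpts S Ax \<B> N A\<rbrakk>
    \<Longrightarrow> hpts S Ax \<B> (App M N) (subst 0 N B)"
| conversion: "\<lbrakk>hpts S Ax \<B> M A; hpts S Ax \<B> B (Cst s); s \<in> S; A =\<^sub>\<beta> B\<rbrakk>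
    \<Longrightarrow> hpts S Ax \<B> M B"
| type_reduction: "\<lbrakk>hpts S Ax \<B> M A; A \<rightarrow>\<^sub>\<beta> B\<rbrakk> \<Longrightarrow> hpts S Ax \<B> M B"
| subject_reduction: "\<lbrakk>hpts S Ax \<B> M A; M \<rightarrow>\<^sub>\<beta> N\<rbrakk> \<Longrightarrow> hpts S Ax \<B> N A"

definition hpts_equivalent ::
    "'c set \<Rightarrow> ('c \<times> 'c) set \<Rightarrow> 'c scheme set \<Rightarrow> ('c \<times> 'c \<times> 'c) set \<Rightarrow> bool" where
  "hpts_equivalent S Ax \<B> R \<longleftrightarrow> (\<forall>M A. pts S Ax R [] M A \<longleftrightarrow> hpts S Ax \<B> M A)"

end

theory Submission
  imports Defs "HOL-Library.Confluence"
begin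

text \<open>
  Write \<open>s\<close> for the sort \<open>s 1\<close>. In an equivalent Hilbert-style system a term whose type converts
  to \<open>s\<close> never comes from an application: if \<open>M : \<Pi>x:A. B\<close>, \<open>N : A\<close> and \<open>B[x:=N]\<close> reduces to
  \<open>s\<close>, then \<open>B : t\<close> for the second component \<open>t\<close> of some rule, so \<open>B[x:=N] : t\<close> and, by subject
  reduction (which need not be proved for the PTS, being a rule of the Hilbert-style system),
  \<open>s : t\<close> is an axiom, which is excluded. Hence every inhabitant of \<open>s\<close> is a constant or a reduct
  of an instance of one of the finitely many schemes.

  On the other hand, going round the cycle of rules produces inhabitants
  \<open>\<Pi>x\<^sub>1:A\<^sub>1. \<dots> \<Pi>x\<^sub>m:A\<^sub>m. N\<close> of \<open>s\<close> with \<open>N\<close> normal and \<open>m\<close> arbitrarily large. As \<open>N\<close> is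
  normal, reduction does not change the length of such a prefix, so by confluence all terms of this
  shape that are reducts of instances of one scheme have the same length. This holds for all
  instances simultaneously, since reductions of an instance come from reductions of the scheme.
\<close>

section \<open>Lifting and substitution\<close>

lemma lift_lift: "i \<le> k \<Longrightarrow> lift (Suc k) (lift i M) = lift i (lift k M)"
  by (induction M arbitrary: i k) auto

lemma subst_lift [simp]: "subst k N (lift k M) = M"
  by (induction M arbitrary: k N) auto

lemma lift_subst_le: "i \<le> k \<Longrightarrow> lift i (subst k N M) = subst (Suc k) (lift i N) (lift i M)"
  by (induction M arbitrary: i k N) (auto simp: lift_lift)

lemma lift_subst_ge: "k \<le> i \<Longrightarrow> lift i (subst k N M) = subst k (lift i N) (lift (Suc i) M)"
  by (induction M arbitrary: i k N) (auto simp: lift_lift)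

lemma subst_subst:
  "i \<le> k \<Longrightarrow> subst k P (subst i N M) = subst i (subst k P N) (subst (Suc k) (lift i P) M)"
  by (induction M arbitrary: i k N P) (auto simp: lift_lift lift_subst_le)

lemma map_pterm_lift: "map_pterm f (lift k M) = lift k (map_pterm f M)"
  by (induction M arbitrary: k) auto

lemma map_pterm_subst: "map_pterm f (subst k N M) = subst k (map_pterm f N) (map_pterm f M)"
  by (induction M arbitrary: k N) (auto simp: map_pterm_lift)

section \<open>Reduction\<close>

abbreviation betas :: "'c pterm \<Rightarrow> 'c pterm \<Rightarrow> bool"  (infix \<open>\<rightarrow>\<^sub>\<beta>\<^sup>*\<close> 50) where
  "M \<rightarrow>\<^sub>\<beta>\<^sup>* N \<equiv> beta\<^sup>*\<^sup>* M N"

inductive_simps beta_Var_iff [simp]: "Var i \<rightarrow>\<^sub>\<beta> P"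
inductive_simps beta_Cst_iff [simp]: "Cst c \<rightarrow>\<^sub>\<beta> P"
inductive_simps beta_Prd_iff: "Prd A B \<rightarrow>\<^sub>\<beta> P"
inductive_simps beta_Lam_iff: "Lam A M \<rightarrow>\<^sub>\<beta> P"
inductive_simps beta_App_iff: "App M N \<rightarrow>\<^sub>\<beta> P"

lemma betas_Cst_iff [simp]: "Cst c \<rightarrow>\<^sub>\<beta>\<^sup>* M \<longleftrightarrow> M = Cst c"
  by (auto elim: converse_rtranclpE)

inductive par :: "'c pterm \<Rightarrow> 'c pterm \<Rightarrow> bool"  (infix \<open>\<Rightarrow>\<^sub>\<beta>\<close> 50) where
  Var: "Var i \<Rightarrow>\<^sub>\<beta> Var i"
| Cst: "Cst c \<Rightarrow>\<^sub>\<beta> Cst c"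
| Prd: "A \<Rightarrow>\<^sub>\<beta> A' \<Longrightarrow> B \<Rightarrow>\<^sub>\<beta> B' \<Longrightarrow> Prd A B \<Rightarrow>\<^sub>\<beta> Prd A' B'"
| Lam: "A \<Rightarrow>\<^sub>\<beta> A' \<Longrightarrow> M \<Rightarrow>\<^sub>\<beta> M' \<Longrightarrow> Lam A M \<Rightarrow>\<^sub>\<beta> Lam A' M'"
| App: "M \<Rightarrow>\<^sub>\<beta> M' \<Longrightarrow> N \<Rightarrow>\<^sub>\<beta> N' \<Longrightarrow> App M N \<Rightarrow>\<^sub>\<beta> App M' N'"
| beta: "M \<Rightarrow>\<^sub>\<beta> M' \<Longrightarrow> N \<Rightarrow>\<^sub>\<beta> N' \<Longrightarrow> App (Lam A M) N \<Rightarrow>\<^sub>\<beta> subst 0 N' M'"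

inductive_cases par_LamE: "Lam A M \<Rightarrow>\<^sub>\<beta> P"

lemma par_refl [simp]: "M \<Rightarrow>\<^sub>\<beta> M"
  by (induction M) (auto intro: par.intros)

lemma beta_imp_par: "M \<rightarrow>\<^sub>\<beta> N \<Longrightarrow> M \<Rightarrow>\<^sub>\<beta> N"
  by (induction rule: beta.induct) (auto intro: par.intros)

lemma rtranclp_map2:
  assumes left: "\<And>x x' y. r x x' \<Longrightarrow> t (f x y) (f x' y)"
    and right: "\<And>x y y'. s y y' \<Longrightarrow> t (f x y) (f x y')"
    and "r\<^sup>*\<^sup>* x x'" and "s\<^sup>*\<^sup>* y y'"
  shows "t\<^sup>*\<^sup>* (f x y) (f x' y')"
proof -
  from \<open>r\<^sup>*\<^sup>* x x'\<close> have "t\<^sup>*\<^sup>* (f x y) (f x' y)"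
    by induction (auto intro: left rtranclp.rtrancl_into_rtrancl)
  also from \<open>s\<^sup>*\<^sup>* y y'\<close> have "t\<^sup>*\<^sup>* (f x' y) (f x' y')"
    by induction (auto intro: right rtranclp.rtrancl_into_rtrancl)
  finally show ?thesis .
qed

lemma par_imp_betas: "M \<Rightarrow>\<^sub>\<beta> N \<Longrightarrow> M \<rightarrow>\<^sub>\<beta>\<^sup>* N"
proof (induction rule: par.induct)
  case (Prd A A' B B')
  then show ?case by (intro rtranclp_map2[where f = Prd]) (auto intro: beta.intros)
next
  case (Lam A A' M M')
  then show ?case by (intro rtranclp_map2[where f = Lam]) (auto intro: beta.intros)
next
  case (App M M' N N')
  then show ?case by (intro rtranclp_map2[where f = App]) (auto intro: beta.intros)
next
  case (beta M M' N N' A)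
  then have "App (Lam A M) N \<rightarrow>\<^sub>\<beta>\<^sup>* App (Lam A M') N'"
    by (intro rtranclp_map2[where f = "\<lambda>M. App (Lam A M)"]) (auto intro: beta.intros)
  also have "App (Lam A M') N' \<rightarrow>\<^sub>\<beta> subst 0 N' M'"
    by (rule beta.beta)
  finally show ?case .
qed auto

lemma rtranclp_par_eq_betas: "par\<^sup>*\<^sup>* = beta\<^sup>*\<^sup>*"
  by (rule rtranclp_subset) (auto intro: beta_imp_par par_imp_betas)

lemma par_lift: "M \<Rightarrow>\<^sub>\<beta> N \<Longrightarrow> lift k M \<Rightarrow>\<^sub>\<beta> lift k N"
  by (induction arbitrary: k rule: par.induct) (auto simp: lift_subst_ge intro: par.intros)

lemma par_subst: "M \<Rightarrow>\<^sub>\<beta> M' \<Longrightarrow> N \<Rightarrow>\<^sub>\<beta> N' \<Longrightarrow> subst k N M \<Rightarrow>\<^sub>\<beta> subst k N' M'"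
  by (induction arbitrary: k N N' rule: par.induct)
    (auto simp: subst_subst par.intros par_lift)

fun complete_development :: "'c pterm \<Rightarrow> 'c pterm" where
  "complete_development (Var i) = Var i"
| "complete_development (Cst c) = Cst c"
| "complete_development (Prd A B) = Prd (complete_development A) (complete_development B)"
| "complete_development (Lam A M) = Lam (complete_development A) (complete_development M)"
| "complete_development (App (Lam A M) N) =
    subst 0 (complete_development N) (complete_development M)"
| "complete_development (App M N) = App (complete_development M) (complete_development N)"

lemma par_complete_development: "M \<Rightarrow>\<^sub>\<beta> N \<Longrightarrow> N \<Rightarrow>\<^sub>\<beta> complete_development M"
proof (induction rule: par.induct)
  case (App M M' N N')
  then show ?case by (cases M) (auto elim!: par_LamE intro: par.intros)
qed (auto intro: par.intros par_subst)

lemma confluentp_beta: "confluentp beta"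
proof -
  have "strong_confluentp par"
    by rule (blast intro: par_complete_development)
  then have "confluentp par"
    by (rule strong_confluentp_imp_confluentp)
  then show ?thesis
    by (simp add: confluentp_def rtranclp_conversep rtranclp_par_eq_betas)
qed

lemma beta_eq_CstD: "M =\<^sub>\<beta> Cst c \<Longrightarrow> M \<rightarrow>\<^sub>\<beta>\<^sup>* Cst c"
  by (auto simp: semiconfluentp_equivclp[OF confluentp_imp_semiconfluentp[OF confluentp_beta]]
      rtranclp_conversep)

section \<open>Maps of pseudoterms\<close>

text \<open>In \<open>h k\<close> the index \<open>k\<close> counts the binders that have been crossed. Lifting, substitution
  and maps of the constants all have this form.\<close>

locale binding_map =
  fixes h :: "nat \<Rightarrow> 'a pterm \<Rightarrow> 'b pterm"
  assumes map_Prd [simp]: "h k (Prd A B) = Prd (h k A) (h (Suc k) B)"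
    and map_Lam [simp]: "h k (Lam A M) = Lam (h k A) (h (Suc k) M)"
    and map_App [simp]: "h k (App M N) = App (h k M) (h k N)"
    and map_subst: "h k (subst 0 N M) = subst 0 (h k N) (h (Suc k) M)"
begin

lemma map_beta: "M \<rightarrow>\<^sub>\<beta> N \<Longrightarrow> h k M \<rightarrow>\<^sub>\<beta> h k N"
  by (induction arbitrary: k rule: beta.induct) (auto simp: map_subst intro: beta.intros)

lemma map_beta_eq: "M =\<^sub>\<beta> N \<Longrightarrow> h k M =\<^sub>\<beta> h k N"
  by (induction rule: equivclp_induct) (auto intro: map_beta equivclp_into_equivclp)

end

locale renaming = binding_map h for h :: "nat \<Rightarrow> 'a pterm \<Rightarrow> 'b pterm" +
  assumes map_Var_ex: "\<exists>j. h k (Var i) = Var j"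
    and map_Cst_ex: "\<exists>d. h k (Cst c) = Cst d"
begin

lemma map_eq_PrdE:
  assumes "h k M = Prd A B"
  obtains A' B' where "M = Prd A' B'" "A = h k A'" "B = h (Suc k) B'"
  using assms map_Var_ex map_Cst_ex by (cases M) (auto, (metis pterm.distinct)+)

lemma map_eq_LamE:
  assumes "h k M = Lam A N"
  obtains A' N' where "M = Lam A' N'" "A = h k A'" "N = h (Suc k) N'"
  using assms map_Var_ex map_Cst_ex by (cases M) (auto, (metis pterm.distinct)+)

lemma beta_mapD: "h k M \<rightarrow>\<^sub>\<beta> P \<Longrightarrow> \<exists>N. M \<rightarrow>\<^sub>\<beta> N \<and> P = h k N"
proof (induction M arbitrary: k P)
  case (Var i)
  then show ?case using map_Var_ex[of k i] by auto
next
  case (Cst c)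
  then show ?case using map_Cst_ex[of k c] by auto
next
  case (Prd A B)
  from Prd.prems consider A' where "h k A \<rightarrow>\<^sub>\<beta> A'" "P = Prd A' (h (Suc k) B)"
    | B' where "h (Suc k) B \<rightarrow>\<^sub>\<beta> B'" "P = Prd (h k A) B'"
    by (auto simp: beta_Prd_iff)
  then show ?case
    by cases (metis Prd.IH(1) beta.Prd1 map_Prd, metis Prd.IH(2) beta.Prd2 map_Prd)
next
  case (Lam A M)
  from Lam.prems consider A' where "h k A \<rightarrow>\<^sub>\<beta> A'" "P = Lam A' (h (Suc k) M)"
    | M' where "h (Suc k) M \<rightarrow>\<^sub>\<beta> M'" "P = Lam (h k A) M'"
    by (auto simp: beta_Lam_iff)
  then show ?case
    by cases (metis Lam.IH(1) beta.Lam1 map_Lam, metis Lam.IH(2) beta.Lam2 map_Lam)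
next
  case (App M N)
  from App.prems consider (redex) A M' where "h k M = Lam A M'" "P = subst 0 (h k N) M'"
    | (left) M' where "h k M \<rightarrow>\<^sub>\<beta> M'" "P = App M' (h k N)"
    | (right) N' where "h k N \<rightarrow>\<^sub>\<beta> N'" "P = App (h k M) N'"
    by (auto simp: beta_App_iff)
  then show ?case
  proof cases
    case redex
    from redex(1) obtain A' M'' where "M = Lam A' M''" "M' = h (Suc k) M''"
      by (rule map_eq_LamE)
    with redex(2) show ?thesis by (metis beta.beta map_subst)
  qed (metis App.IH(1) beta.App1 map_App, metis App.IH(2) beta.App2 map_App)
qed

lemma betas_mapE:
  assumes "h k M \<rightarrow>\<^sub>\<beta>\<^sup>* P"
  obtains N where "M \<rightarrow>\<^sub>\<beta>\<^sup>* N" "P = h k N"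
proof -
  from assms have "\<exists>N. M \<rightarrow>\<^sub>\<beta>\<^sup>* N \<and> P = h k N"
    by induction (blast dest: beta_mapD intro: rtranclp.rtrancl_into_rtrancl)+
  with that show ?thesis by blast
qed

lemma beta_normal_map [simp]: "beta_normal (h k M) \<longleftrightarrow> beta_normal M"
  unfolding beta_normal_def by (blast intro: map_beta dest: beta_mapD)

end

primrec map_ctx :: "(nat \<Rightarrow> 'a pterm \<Rightarrow> 'b pterm) \<Rightarrow> 'a pterm list \<Rightarrow> 'b pterm list" where
  "map_ctx h [] = []"
| "map_ctx h (A # \<Delta>) = h (length \<Delta>) A # map_ctx h \<Delta>"

locale context_map = binding_map h for h :: "nat \<Rightarrow> 'c pterm \<Rightarrow> 'c pterm" +
  assumes map_Cst [simp]: "h k (Cst c) = Cst c"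
    and map_Var_0 [simp]: "h (Suc k) (Var 0) = Var 0"
    and map_lift [simp]: "h (Suc k) (lift 0 M) = lift 0 (h k M)"
begin

text \<open>The rules that hold in every context commute with \<open>h\<close>, so that only axioms,
  \<open>start\<close> and \<open>weakening\<close> have to be treated separately, and only where they reach \<open>\<Gamma>\<close>.\<close>

lemma pts_map_ctx:
  assumes "pts S Ax R (\<Delta> @ \<Gamma>) M B"
    and base_axiom: "\<And>c s. \<lbrakk>\<Gamma> = []; (c, s) \<in> Ax\<rbrakk> \<Longrightarrow> pts S Ax R \<Gamma>' (Cst c) (Cst s)"
    and base_start: "\<And>\<Gamma>\<^sub>0 A s. \<lbrakk>\<Gamma> = A # \<Gamma>\<^sub>0; pts S Ax R \<Gamma>\<^sub>0 A (Cst s); s \<in> S\<rbrakk>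
      \<Longrightarrow> pts S Ax R \<Gamma>' (h 0 (Var 0)) (h 0 (lift 0 A))"
    and base_weakening: "\<And>\<Gamma>\<^sub>0 A s M B.
      \<lbrakk>\<Gamma> = A # \<Gamma>\<^sub>0; pts S Ax R \<Gamma>\<^sub>0 M B; pts S Ax R \<Gamma>\<^sub>0 A (Cst s); s \<in> S\<rbrakk>
      \<Longrightarrow> pts S Ax R \<Gamma>' (h 0 (lift 0 M)) (h 0 (lift 0 B))"
  shows "pts S Ax R (map_ctx h \<Delta> @ \<Gamma>') (h (length \<Delta>) M) (h (length \<Delta>) B)"
  using assms(1)
proof (induction "\<Delta> @ \<Gamma>" M B arbitrary: \<Delta> rule: pts.induct)
  case (axiom c s)
  then show ?case by (simp add: base_axiom)
next
  case (start \<Gamma>'' A s)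
  show ?case
  proof (cases \<Delta>)
    case Nil
    with start base_start[of A \<Gamma>'' s] show ?thesis by simp
  next
    case (Cons A' \<Delta>')
    with start show ?thesis by (auto intro: pts.start)
  qed
next
  case (weakening \<Gamma>'' M B A s)
  show ?case
  proof (cases \<Delta>)
    case Nil
    with weakening base_weakening[of A \<Gamma>'' M B s] show ?thesis by simp
  next
    case (Cons A' \<Delta>')
    with weakening show ?thesis by (auto intro: pts.weakening)
  qed
next
  case (application M A B N)
  then show ?case by (auto simp: map_subst intro: pts.application)
next
  case (abstraction A M B s)
  from abstraction.hyps(2)[of "A # \<Delta>"] abstraction.hyps(4,5) show ?case
    by (auto intro: pts.abstraction)
next
  case (product A B s2 s1 s3)
  from product.hyps(2)[of "A # \<Delta>"] product.hyps(4,5) show ?case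
    by (auto intro: pts.product)
next
  case (conversion M A B s)
  then show ?case by (auto intro: pts.conversion map_beta_eq)
qed

end

interpretation lift: renaming lift
  by unfold_locales (auto simp: lift_subst_ge)

interpretation lift: context_map lift
  by unfold_locales (auto simp: lift_lift)

interpretation subst: context_map "\<lambda>k. subst k ((lift 0 ^^ k) N)" for N
  by unfold_locales (auto simp: subst_subst lift_subst_le)

interpretation map_pterm: renaming "\<lambda>_. map_pterm f" for f
  by unfold_locales (auto simp: map_pterm_subst)

section \<open>Metatheory of pure type systems\<close>

lemma pts_thinning:
  assumes "pts S Ax R (\<Delta> @ \<Gamma>) M B" and A: "pts S Ax R \<Gamma> A (Cst s)" "s \<in> S"
  shows "pts S Ax R (map_ctx lift \<Delta> @ A # \<Gamma>) (lift (length \<Delta>) M) (lift (length \<Delta>) B)"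
proof -
  have weaken: "pts S Ax R (A # \<Gamma>) (lift 0 M) (lift 0 B)" if "pts S Ax R \<Gamma> M B" for M B
    using that A by (rule pts.weakening)
  show ?thesis
  proof (rule lift.pts_map_ctx[OF assms(1)])
    show "pts S Ax R (A # \<Gamma>) (Cst c) (Cst t)" if "\<Gamma> = []" "(c, t) \<in> Ax" for c t
      using weaken[of "Cst c" "Cst t"] that by (simp add: pts.axiom)
    show "pts S Ax R (A # \<Gamma>) (lift 0 (Var 0)) (lift 0 (lift 0 C))"
      if \<Gamma>: "\<Gamma> = C # \<Gamma>\<^sub>0" and C: "pts S Ax R \<Gamma>\<^sub>0 C (Cst t)" "t \<in> S" for \<Gamma>\<^sub>0 C t
      by (rule weaken) (unfold \<Gamma>, rule pts.start[OF C])
    show "pts S Ax R (A # \<Gamma>) (lift 0 (lift 0 N)) (lift 0 (lift 0 D))"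
      if \<Gamma>: "\<Gamma> = C # \<Gamma>\<^sub>0" and N: "pts S Ax R \<Gamma>\<^sub>0 N D"
        and C: "pts S Ax R \<Gamma>\<^sub>0 C (Cst t)" "t \<in> S" for \<Gamma>\<^sub>0 C t N D
      by (rule weaken) (unfold \<Gamma>, rule pts.weakening[OF N C])
  qed
qed

lemma pts_subst:
  assumes "pts S Ax R (A # \<Gamma>) M B" and "pts S Ax R \<Gamma> N A"
  shows "pts S Ax R \<Gamma> (subst 0 N M) (subst 0 N B)"
  using assms
  by (intro subst.pts_map_ctx[of S Ax R "[]" "A # \<Gamma>" M B \<Gamma> N, simplified]) auto

lemma pts_Prd_generation:
  assumes "pts S Ax R \<Gamma> (Prd A B) C"
  shows "\<exists>s1 s2 s3. (s1, s2, s3) \<in> R \<and> pts S Ax R \<Gamma> A (Cst s1) \<and>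
    pts S Ax R (A # \<Gamma>) B (Cst s2) \<and> C =\<^sub>\<beta> Cst s3"
  using assms
proof (induction \<Gamma> "Prd A B" C arbitrary: A B rule: pts.induct)
  case (weakening \<Gamma> M C D t)
  from weakening.hyps(6) obtain A' B' where
    M: "M = Prd A' B'" and AB: "A = lift 0 A'" "B = lift (Suc 0) B'"
    by (rule lift.map_eq_PrdE)
  from weakening.hyps(2)[OF M] obtain s1 s2 s3 where rule: "(s1, s2, s3) \<in> R"
    and A': "pts S Ax R \<Gamma> A' (Cst s1)" and B': "pts S Ax R ([A'] @ \<Gamma>) B' (Cst s2)"
    and C: "C =\<^sub>\<beta> Cst s3"
    by auto
  have "pts S Ax R (D # \<Gamma>) A (Cst s1)"
    using pts.weakening[OF A' weakening.hyps(3,5)] by (simp add: AB)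
  moreover have "pts S Ax R (A # D # \<Gamma>) B (Cst s2)"
    using pts_thinning[OF B' weakening.hyps(3,5)] by (simp add: AB)
  moreover have "lift 0 C =\<^sub>\<beta> Cst s3"
    using lift.map_beta_eq[OF C, of 0] by simp
  ultimately show ?case using rule by blast
next
  case (product \<Gamma> A B s2 s1 s3)
  from product.hyps(1,3,5) equivclp_refl[of beta "Cst s3"] show ?case by blast
next
  case (conversion \<Gamma> C D t)
  from conversion.hyps(2) obtain s1 s2 s3 where "(s1, s2, s3) \<in> R"
    "pts S Ax R \<Gamma> A (Cst s1)" "pts S Ax R (A # \<Gamma>) B (Cst s2)" and C: "C =\<^sub>\<beta> Cst s3"
    by blast
  moreover have "D =\<^sub>\<beta> Cst s3"
    using equivclp_sym[OF conversion.hyps(6)] C by (rule equivclp_trans)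
  ultimately show ?case by blast
qed

lemma pts_Cst_generation:
  assumes "pts S Ax R \<Gamma> (Cst c) A"
  shows "\<exists>s. (c, s) \<in> Ax \<and> A =\<^sub>\<beta> Cst s"
  using assms
proof (induction \<Gamma> "Cst c" A rule: pts.induct)
  case (weakening \<Gamma> M B A t)
  from weakening.hyps(6) have "M = Cst c" by (cases M) (auto split: if_splits)
  with weakening.hyps(2) obtain s where "(c, s) \<in> Ax" "B =\<^sub>\<beta> Cst s" by blast
  with lift.map_beta_eq[of B "Cst s" 0] show ?case by auto
next
  case (conversion \<Gamma> A B t)
  then show ?case by (meson equivclp_sym equivclp_trans)
qed auto

lemma pts_codomain_instance:
  assumes "pts S Ax R \<Gamma> (Prd A B) C" and "pts S Ax R \<Gamma> N A"
  obtains s1 s2 s3 where "(s1, s2, s3) \<in> R" "pts S Ax R \<Gamma> (subst 0 N B) (Cst s2)"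
proof -
  from pts_Prd_generation[OF assms(1)] obtain s1 s2 s3
    where rule: "(s1, s2, s3) \<in> R" and B: "pts S Ax R (A # \<Gamma>) B (Cst s2)" by blast
  have "pts S Ax R \<Gamma> (subst 0 N B) (Cst s2)"
    using pts_subst[OF B assms(2)] by simp
  with rule show thesis by (rule that)
qed

lemma pts_type_correct:
  assumes "pts_spec S Ax R" and "pts S Ax R \<Gamma> M A"
  shows "(\<exists>s. A = Cst s) \<or> (\<exists>s\<in>S. pts S Ax R \<Gamma> A (Cst s))"
  using assms(2)
proof (induction rule: pts.induct)
  case (start \<Gamma> A s)
  then show ?case using pts.weakening[OF start.hyps(1,1,2)] by auto
next
  case (weakening \<Gamma> M B A s)
  from weakening.IH(1) consider (sort) t where "B = Cst t"
    | (typed) t where "t \<in> S" "pts S Ax R \<Gamma> B (Cst t)" by blast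
  then show ?case
  proof cases
    case typed
    with pts.weakening[OF this(2) weakening.hyps(2,3)] show ?thesis by auto
  qed simp
next
  case (application \<Gamma> M A B N)
  then obtain t where "pts S Ax R \<Gamma> (Prd A B) (Cst t)" by auto
  then obtain s1 s2 s3 where "(s1, s2, s3) \<in> R" "pts S Ax R \<Gamma> (subst 0 N B) (Cst s2)"
    using application.hyps(2) by (rule pts_codomain_instance)
  with assms(1) show ?case by (auto simp: pts_spec_def)
qed auto

section \<open>Product prefixes\<close>

fun pi_depth :: "'c pterm \<Rightarrow> nat" where
  "pi_depth (Prd A B) = Suc (pi_depth B)"
| "pi_depth _ = 0"

fun normal_target :: "'c pterm \<Rightarrow> bool" where
  "normal_target (Prd A B) \<longleftrightarrow> normal_target B"
| "normal_target M \<longleftrightarrow> beta_normal M"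

lemma beta_normal_imp_normal_target: "beta_normal M \<Longrightarrow> normal_target M"
  by (induction M) (auto simp: beta_normal_def intro: beta.intros)

lemma beta_normal_target:
  "M \<rightarrow>\<^sub>\<beta> N \<Longrightarrow> normal_target M \<Longrightarrow> normal_target N \<and> pi_depth N = pi_depth M"
  by (induction rule: beta.induct) (auto simp: beta_normal_def intro: beta.intros)

lemma betas_normal_target:
  "M \<rightarrow>\<^sub>\<beta>\<^sup>* N \<Longrightarrow> normal_target M \<Longrightarrow> normal_target N \<and> pi_depth N = pi_depth M"
  by (induction rule: rtranclp_induct) (auto dest: beta_normal_target)

lemma pi_depth_normal_target_unique:
  assumes "M \<rightarrow>\<^sub>\<beta>\<^sup>* T" "normal_target T" and "M \<rightarrow>\<^sub>\<beta>\<^sup>* U" "normal_target U"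
  shows "pi_depth T = pi_depth U"
proof -
  obtain Q where "T \<rightarrow>\<^sub>\<beta>\<^sup>* Q" "U \<rightarrow>\<^sub>\<beta>\<^sup>* Q"
    using confluentpD[OF confluentp_beta assms(1,3)] by blast
  with assms(2,4) show ?thesis by (metis betas_normal_target)
qed

lemma finite_pi_depths_of_reducts: "finite (pi_depth ` {T. M \<rightarrow>\<^sub>\<beta>\<^sup>* T \<and> normal_target T})"
proof -
  obtain d where "pi_depth T = d" if "M \<rightarrow>\<^sub>\<beta>\<^sup>* T" "normal_target T" for T
    by (metis pi_depth_normal_target_unique)
  then have "pi_depth ` {T. M \<rightarrow>\<^sub>\<beta>\<^sup>* T \<and> normal_target T} \<subseteq> {d}" by blast
  then show ?thesis by (rule finite_subset) simp
qed

context renaming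
begin

lemma pi_depth_map [simp]: "pi_depth (h k M) = pi_depth M"
proof (induction M arbitrary: k)
  case (Var i)
  show ?case using map_Var_ex[of k i] by auto
next
  case (Cst c)
  show ?case using map_Cst_ex[of k c] by auto
qed auto

lemma normal_target_map [simp]: "normal_target (h k M) \<longleftrightarrow> normal_target M"
proof (induction M arbitrary: k)
  case (Var i)
  show ?case using map_Var_ex[of k i] by (auto simp: beta_normal_def)
next
  case (Cst c)
  show ?case using map_Cst_ex[of k c] by (auto simp: beta_normal_def)
next
  case (Lam A M)
  show ?case using beta_normal_map[of k "Lam A M"] by simp
next
  case (App M N)
  show ?case using beta_normal_map[of k "App M N"] by simp
qed auto

end

section \<open>Inhabitants in Hilbert-style systems\<close>

definition scheme_reduct :: "'c scheme set \<Rightarrow> 'c pterm \<Rightarrow> bool" where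
  "scheme_reduct \<B> M \<longleftrightarrow> (\<exists>M\<^sub>0 A\<^sub>0 \<sigma>. (M\<^sub>0, A\<^sub>0) \<in> \<B> \<and> inst \<sigma> M\<^sub>0 \<rightarrow>\<^sub>\<beta>\<^sup>* M)"

lemma scheme_reduct_beta: "scheme_reduct \<B> M \<Longrightarrow> M \<rightarrow>\<^sub>\<beta> N \<Longrightarrow> scheme_reduct \<B> N"
  unfolding scheme_reduct_def by (meson rtranclp.rtrancl_into_rtrancl)

lemma finite_pi_depths_of_scheme_reducts:
  assumes "finite \<B>"
  shows "finite (pi_depth ` {T. scheme_reduct \<B> T \<and> normal_target T})"
proof (rule finite_subset)
  let ?depths = "\<lambda>M\<^sub>0. pi_depth ` {T. M\<^sub>0 \<rightarrow>\<^sub>\<beta>\<^sup>* T \<and> normal_target T}"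
  show "pi_depth ` {T. scheme_reduct \<B> T \<and> normal_target T} \<subseteq> (\<Union>(M\<^sub>0, A\<^sub>0)\<in>\<B>. ?depths M\<^sub>0)"
  proof clarify
    fix T assume "scheme_reduct \<B> T" and normal: "normal_target T"
    then obtain M\<^sub>0 A\<^sub>0 \<sigma> where scheme: "(M\<^sub>0, A\<^sub>0) \<in> \<B>" and "inst \<sigma> M\<^sub>0 \<rightarrow>\<^sub>\<beta>\<^sup>* T"
      by (auto simp: scheme_reduct_def)
    from this(2) obtain U where "M\<^sub>0 \<rightarrow>\<^sub>\<beta>\<^sup>* U" "T = inst \<sigma> U"
      unfolding inst_def by (rule map_pterm.betas_mapE)
    with normal have "pi_depth T \<in> ?depths M\<^sub>0" by (auto simp: inst_def)
    with scheme show "pi_depth T \<in> (\<Union>(M\<^sub>0, A\<^sub>0)\<in>\<B>. ?depths M\<^sub>0)" by blast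
  qed
  show "finite (\<Union>(M\<^sub>0, A\<^sub>0)\<in>\<B>. ?depths M\<^sub>0)"
    using assms finite_pi_depths_of_reducts by auto
qed

lemma hpts_subject_betas: "M \<rightarrow>\<^sub>\<beta>\<^sup>* N \<Longrightarrow> hpts S Ax \<B> M A \<Longrightarrow> hpts S Ax \<B> N A"
  by (induction rule: rtranclp_induct) (auto intro: hpts.subject_reduction)

lemma hpts_App_Cst_axiom:
  assumes spec: "pts_spec S Ax R" and eq: "hpts_equivalent S Ax \<B> R"
    and M: "hpts S Ax \<B> M (Prd A B)" and N: "hpts S Ax \<B> N A" and B: "subst 0 N B =\<^sub>\<beta> Cst c"
  obtains s1 s2 s3 where "(s1, s2, s3) \<in> R" "(c, s2) \<in> Ax"
proof -
  have pts_iff_hpts: "pts S Ax R [] P C \<longleftrightarrow> hpts S Ax \<B> P C" for P C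
    using eq by (simp add: hpts_equivalent_def)
  obtain t where "pts S Ax R [] (Prd A B) (Cst t)"
    using pts_type_correct[OF spec] M pts_iff_hpts by blast
  moreover have "pts S Ax R [] N A" using N pts_iff_hpts by simp
  ultimately obtain s1 s2 s3
    where rule: "(s1, s2, s3) \<in> R" and "pts S Ax R [] (subst 0 N B) (Cst s2)"
    by (rule pts_codomain_instance)
  then have "hpts S Ax \<B> (subst 0 N B) (Cst s2)" by (simp add: pts_iff_hpts)
  with beta_eq_CstD[OF B] have "hpts S Ax \<B> (Cst c) (Cst s2)" by (rule hpts_subject_betas)
  then have "pts S Ax R [] (Cst c) (Cst s2)" by (simp add: pts_iff_hpts)
  from pts_Cst_generation[OF this] obtain s where "(c, s) \<in> Ax" "Cst s2 =\<^sub>\<beta> Cst s" by blast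
  then have "(c, s2) \<in> Ax" by (auto dest: beta_eq_CstD)
  with rule show thesis by (rule that)
qed

lemma hpts_inhabitant_cases:
  assumes spec: "pts_spec S Ax R" and eq: "hpts_equivalent S Ax \<B> R"
    and no_axiom: "\<And>s1 s2 s3. (s1, s2, s3) \<in> R \<Longrightarrow> (c, s2) \<notin> Ax"
    and "hpts S Ax \<B> M C" and "C =\<^sub>\<beta> Cst c"
  shows "(\<exists>d. M = Cst d) \<or> scheme_reduct \<B> M"
  using assms(4,5)
proof (induction rule: hpts.induct)
  case (axiom d s)
  then show ?case by simp
next
  case (scheme M A \<sigma>)
  then show ?case by (auto simp: scheme_reduct_def)
next
  case (application M A B N)
  from spec eq application.hyps application.prems obtain s1 s2 s3
    where "(s1, s2, s3) \<in> R" "(c, s2) \<in> Ax" by (rule hpts_App_Cst_axiom)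
  with no_axiom show ?case by blast
next
  case (conversion M A B s)
  from conversion.hyps(4) conversion.prems have "A =\<^sub>\<beta> Cst c" by (rule equivclp_trans)
  then show ?case by (rule conversion.IH(1))
next
  case (type_reduction M A B)
  from r_into_equivclp[of beta, OF type_reduction.hyps(2)] type_reduction.prems
  have "A =\<^sub>\<beta> Cst c" by (rule equivclp_trans)
  then show ?case by (rule type_reduction.IH)
next
  case (subject_reduction M A N)
  then show ?case using scheme_reduct_beta by auto
qed

section \<open>Depths of the inhabitants of a sort\<close>

definition normal_target_inhabitants ::
    "'c set \<Rightarrow> ('c \<times> 'c) set \<Rightarrow> ('c \<times> 'c \<times> 'c) set \<Rightarrow> 'c \<Rightarrow> 'c pterm set" where
  "normal_target_inhabitants S Ax R s = {T. pts S Ax R [] T (Cst s) \<and> normal_target T}"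

lemma finite_pi_depths_if_hpts_equivalent:
  assumes "pts_spec S Ax R" and "hpts_spec S Ax \<B>" and "hpts_equivalent S Ax \<B> R"
    and "\<And>s1 s2 s3. (s1, s2, s3) \<in> R \<Longrightarrow> (s, s2) \<notin> Ax"
  shows "finite (pi_depth ` normal_target_inhabitants S Ax R s)"
proof (rule finite_subset)
  let ?D = "pi_depth ` {T. scheme_reduct \<B> T \<and> normal_target T}"
  have "(\<exists>d. T = Cst d) \<or> scheme_reduct \<B> T" if "pts S Ax R [] T (Cst s)" for T
  proof (rule hpts_inhabitant_cases[OF assms(1,3,4)])
    show "hpts S Ax \<B> T (Cst s)" using that assms(3) by (simp add: hpts_equivalent_def)
  qed simp_all
  then show "pi_depth ` normal_target_inhabitants S Ax R s \<subseteq> insert 0 ?D"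
    by (fastforce simp: normal_target_inhabitants_def)
  show "finite (insert 0 ?D)"
    using assms(2) by (simp add: hpts_spec_def finite_pi_depths_of_scheme_reducts)
qed

definition sort_step ::
    "'c set \<Rightarrow> ('c \<times> 'c) set \<Rightarrow> ('c \<times> 'c \<times> 'c) set \<Rightarrow> 'c \<Rightarrow> 'c \<Rightarrow> bool" where
  "sort_step S Ax R s t \<longleftrightarrow> (\<exists>s'\<in>inhabited_sorts S Ax R. (s', s, t) \<in> R)"

lemma sort_step_pi_depth:
  assumes "sort_step S Ax R s t" and "T \<in> normal_target_inhabitants S Ax R s"
  shows "\<exists>U\<in>normal_target_inhabitants S Ax R t. pi_depth U = Suc (pi_depth T)"
proof -
  from assms(1) obtain s' A where rule: "(s', s, t) \<in> R"
    and A: "s' \<in> S" "pts S Ax R [] A (Cst s')"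
    by (auto simp: sort_step_def inhabited_sorts_def)
  from assms have T: "pts S Ax R [] T (Cst s)" "normal_target T"
    by (simp_all add: normal_target_inhabitants_def)
  have "pts S Ax R [A] (lift 0 T) (Cst s)"
    using pts.weakening[OF T(1) A(2,1)] by simp
  then have "pts S Ax R [] (Prd A (lift 0 T)) (Cst t)"
    using A(2) rule by (rule pts.product)
  with T(2) have "Prd A (lift 0 T) \<in> normal_target_inhabitants S Ax R t"
    by (simp add: normal_target_inhabitants_def)
  then show ?thesis by (rule rev_bexI) simp
qed

lemma relpowp_sort_step_pi_depth:
  assumes "(sort_step S Ax R ^^ m) s t" and "T \<in> normal_target_inhabitants S Ax R s"
  shows "\<exists>U\<in>normal_target_inhabitants S Ax R t. pi_depth U = pi_depth T + m"
  using assms(1)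
proof (induction m arbitrary: t)
  case 0
  with assms(2) show ?case by auto
next
  case (Suc m)
  from Suc.prems obtain t' where "(sort_step S Ax R ^^ m) s t'" "sort_step S Ax R t' t"
    by (rule relpowp_Suc_E)
  with Suc.IH sort_step_pi_depth show ?case by (metis add_Suc_right)
qed

lemma infinite_pi_depths_if_sort_cycle:
  assumes "(sort_step S Ax R ^^ m) s s" and "m > 0" and "s \<in> nf_inhabited_sorts S Ax R"
  shows "infinite (pi_depth ` normal_target_inhabitants S Ax R s)" (is "infinite ?D")
proof
  assume "finite ?D"
  moreover have "?D \<noteq> {}"
    using assms(3) beta_normal_imp_normal_target
    by (auto simp: nf_inhabited_sorts_def normal_target_inhabitants_def)
  ultimately have "Max ?D \<in> ?D" by (rule Max_in)
  then obtain T where "T \<in> normal_target_inhabitants S Ax R s" and "pi_depth T = Max ?D"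
    by force
  with relpowp_sort_step_pi_depth[OF assms(1)] have "Max ?D + m \<in> ?D" by force
  with \<open>finite ?D\<close> have "Max ?D + m \<le> Max ?D" by (rule Max_ge)
  with assms(2) show False by simp
qed

theorem theorem14:
  fixes S :: "'c set" and Ax :: "('c \<times> 'c) set" and R :: "('c \<times> 'c \<times> 'c) set"
    and n :: nat and s :: "nat \<Rightarrow> 'c"
  assumes "pts_spec S Ax R"
    and "n > 1"
    and "\<forall>i\<in>{1..n}. s i \<in> S"
    and "s 1 = s n"
    and "s 1 \<in> nf_inhabited_sorts S Ax R"
    and "\<forall>i. 1 \<le> i \<and> i < n \<longrightarrow> (\<exists>s'\<in>inhabited_sorts S Ax R. (s', s i, s (i + 1)) \<in> R)"
    and "\<forall>s1' s2' s3'. (s1', s2', s3') \<in> R \<longrightarrow> (s 1, s2') \<notin> Ax"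
  shows "\<nexists>\<B>. hpts_spec S Ax \<B> \<and> hpts_equivalent S Ax \<B> R"
proof
  assume "\<exists>\<B>. hpts_spec S Ax \<B> \<and> hpts_equivalent S Ax \<B> R"
  then obtain \<B> where "hpts_spec S Ax \<B>" "hpts_equivalent S Ax \<B> R" by blast
  with assms(1,7) have "finite (pi_depth ` normal_target_inhabitants S Ax R (s 1))"
    by (intro finite_pi_depths_if_hpts_equivalent) auto
  moreover have "(sort_step S Ax R ^^ (n - 1)) (s 1) (s 1)"
    unfolding relpowp_fun_conv
  proof (intro exI[of _ "\<lambda>i. s (Suc i)"] conjI allI impI)
    show "s (Suc (n - 1)) = s 1" using assms(2,4) by simp
    show "sort_step S Ax R (s (Suc i)) (s (Suc (Suc i)))" if "i < n - 1" for i
      using assms(6) that by (auto simp: sort_step_def)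
  qed simp
  then have "infinite (pi_depth ` normal_target_inhabitants S Ax R (s 1))"
    using assms(2,5) by (intro infinite_pi_depths_if_sort_cycle) auto
  ultimately show False by blast
qed

end
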